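(* Let $(\mathfrak g,[\cdot,\cdot],\phi,J)$ be an almost complex Hom-Lie algebra (or the almost complex Hom-Lie algebra $\mathfrak g=\mathfrak g^!$ of a left-invariant almost complex Hom-Lie group $(G,\diamond,e_\Phi,\Phi,J)$) equipped with a pseudo-Riemannian metric $\langle\cdot,\cdot\rangle$ (respectively, a left-invariant pseudo-Riemannian metric). Then the following are equivalent: (a) $(\mathfrak g,[\cdot,\cdot],\phi,J,\langle\cdot,\cdot\rangle)$ is a Kähler-Norden Hom-Lie algebra (respectively, $(G,\diamond,e_\Phi,\Phi,J,\langle\cdot,\cdot\rangle)$ is a left-invariant Kähler-Norden Hom-Lie group); (b) $(\mathfrak g,[\cdot,\cdot],\phi,J,\langle\cdot,\cdot\rangle)$ is a holomorphic Norden Hom-Lie algebra (respectively, $(G,\diamond,e_\Phi,\Phi,J,\langle\cdot,\cdot\rangle)$ is a left-invariant holomorphic Norden Hom-Lie group).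
   Context: Hom-Lie algebras. A Hom-Lie algebra $(\mathfrak g,[\cdot,\cdot],\phi)$ is a finite-dimensional vector space $\mathfrak g$ over $\mathbb K\in\{\mathbb R,\mathbb C\}$ with a skew-symmetric bilinear bracket and a linear map $\phi:\mathfrak g\to\mathfrak g$ such that $\phi[u,v]=[\phi(u),\phi(v)]$ and $[\phi(u),[v,w]]+[\phi(v),[w,u]]+[\phi(w),[u,v]]=0$ for all $u,v,w$. Hom-Lie groups. A Hom-group $(G,\diamond,e_\Phi,\Phi)$ is a set $G$ with a product $\diamond$ and a bijection $\Phi:G\to G$ such that $\Phi(a\diamond b)=\Phi(a)\diamond\Phi(b)$, $\Phi(a)\diamond(b\diamond c)=(a\diamond b)\diamond\Phi(c)$, there is a unique $e_\Phi$ with $a\diamond e_\Phi=e_\Phi\diamond a=\Phi(a)$ for all $a$, and each $a$ has $a^{-1}$ with $a\diamond a^{-1}=a^{-1}\diamond a=e_\Phi$. It is a (real) Hom-Lie group if $G$ is a smooth manifold, $\Phi$ is a diffeomorphism, and product and inversion are smooth. Sections of the pullback bundle $\Phi^!TG$ are identified with linear maps $x:C^\infty(G)\to C^\infty(G)$ with $x(fg)=x(f)\Phi^*(g)+\Phi^*(f)x(g)$; they form a Hom-Lie algebra (infinite-dimensional) with $\phi(x)=\Phi^*\circ x\circ(\Phi^* )^{-1}$ and $[x,y]_\Phi=\Phi^*\circ x\circ(\Phi^* )^{-1}\circ y\circ(\Phi^* )^{-1}-\Phi^*\circ y\circ(\Phi^* )^{-1}\circ x\circ(\Phi^* )^{-1}$.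 A section $x$ is left-invariant if $x(f)(a)=x(f\circ l_a\circ\Phi^{-1})(e_\Phi)$ for all $a\in G$, $f\in C^\infty(G)$, where $l_a b=a\diamond b$. Left-invariant sections form a Hom-Lie subalgebra, which evaluation at $e_\Phi$ identifies with the fibre $\mathfrak g^!$ of $\Phi^!TG$ at $e_\Phi$; the resulting finite-dimensional real Hom-Lie algebra $(\mathfrak g^!,[\cdot,\cdot],\phi)$ is the Hom-Lie algebra of $G$. A left-invariant structure (almost complex structure, metric, connection, Kähler-Norden structure, etc.) on $G$ means the corresponding structure on $\mathfrak g^!$, as defined below. Structures on a Hom-Lie algebra. An almost complex structure is a linear isomorphism $J:\mathfrak g\to\mathfrak g$ with $(\phi\circ J)^2=-\mathrm{Id}$ and $\phi\circ J=J\circ\phi$. Write $\psi=\phi\circ J$. $J$ is integrable (a complex structure) if $N_\psi(x,y)=[\psi x,\psi y]-\psi[\psi x,y]-\psi[x,\psi y]-[x,y]$ vanishes for all $x,y$. A pseudo-Riemannian metric is a symmetric non-degenerate bilinear form $\langle\cdot,\cdot\rangle$ on $\mathfrak g$ with $\langle\phi(x),\phi(y)\rangle=\langle x,y\rangle$. Its Hom-Levi-Civita connection is the unique bilinear map $\nabla:\mathfrak g\times\mathfrak g\to\mathfrak g$, $(x,y)\mapsto\nabla_xy$, with $[x,y]=\nabla_xy-\nabla_yx$ and $\langle\nabla_xy,\phi(z)\rangle=-\langle\phi(y),\nabla_xz\rangle$. The metric is Norden if $\langle\psi x,\psi y\rangle=-\langle x,y\rangle$ (equivalently $\langle\psi x,y\rangle=\langle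 x,\psi y\rangle$); then $(\mathfrak g,[\cdot,\cdot],\phi,J,\langle\cdot,\cdot\rangle)$ is an almost Norden Hom-Lie algebra. A Kähler-Norden Hom-Lie algebra is an almost Norden Hom-Lie algebra with $\nabla\psi=0$, i.e. $\nabla_x(\psi y)=\psi(\nabla_xy)$ for all $x,y$, where $\nabla$ is the Hom-Levi-Civita connection. A holomorphic Norden Hom-Lie algebra is an almost Norden Hom-Lie algebra such that $J$ is integrable and $\Phi_\psi\langle\cdot,\cdot\rangle=0$, where $$(\Phi_\psi\langle\cdot,\cdot\rangle)(x,y,z)=\langle[y,\psi x]-\psi[y,x],\phi(z)\rangle+\langle\phi(y),[z,\psi x]-\psi[z,x]\rangle .$$ *)

theory Defs
  imports "HOL-Analysis.Analysis" "HOL-Library.Function_Algebras"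
begin

section \<open>Hom-Lie algebras\<close>

text \<open>The underlying vector space is a subspace \<open>hl_carrier\<close> of an ambient vector space
  \<open>(UNIV, hl_scale)\<close>, so that spaces of sections on a Hom-Lie group are covered. The operations
  are only constrained, and only used, on the carrier.\<close>

record ('k, 'v) hom_lie =
  hl_carrier :: "'v set"
  hl_scale :: "'k \<Rightarrow> 'v \<Rightarrow> 'v"
  hl_bracket :: "'v \<Rightarrow> 'v \<Rightarrow> 'v"
  hl_twist :: "'v \<Rightarrow> 'v"

definition linear_on ::
  "'v::ab_group_add set \<Rightarrow> ('k \<Rightarrow> 'v \<Rightarrow> 'v) \<Rightarrow> 'w::ab_group_add set \<Rightarrow> ('k \<Rightarrow> 'w \<Rightarrow> 'w) \<Rightarrow> ('v \<Rightarrow> 'w) \<Rightarrow> bool"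
  where "linear_on V s W t f \<longleftrightarrow>
    (\<forall>x\<in>V. f x \<in> W) \<and>
    (\<forall>x\<in>V. \<forall>y\<in>V. f (x + y) = f x + f y) \<and>
    (\<forall>c. \<forall>x\<in>V. f (s c x) = t c (f x))"

definition bilinear_on ::
  "'v::ab_group_add set \<Rightarrow> ('k \<Rightarrow> 'v \<Rightarrow> 'v) \<Rightarrow> 'w::ab_group_add set \<Rightarrow> ('k \<Rightarrow> 'w \<Rightarrow> 'w) \<Rightarrow> ('v \<Rightarrow> 'v \<Rightarrow> 'w) \<Rightarrow> bool"
  where "bilinear_on V s W t b \<longleftrightarrow>
    (\<forall>x\<in>V. linear_on V s W t (\<lambda>y. b x y)) \<and>
    (\<forall>y\<in>V. linear_on V s W t (\<lambda>x. b x y))"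

definition finite_dimensional_subspace ::
  "('k::field \<Rightarrow> 'v::ab_group_add \<Rightarrow> 'v) \<Rightarrow> 'v set \<Rightarrow> bool"
  where "finite_dimensional_subspace s V \<longleftrightarrow>
    vector_space s \<and> module.subspace s V \<and>
    (\<exists>B. finite B \<and> B \<subseteq> V \<and> module.span s B = V)"

definition hom_lie_algebra :: "('k::field, 'v::ab_group_add) hom_lie \<Rightarrow> bool"
  where "hom_lie_algebra L \<longleftrightarrow>
    (let V = hl_carrier L; s = hl_scale L; br = hl_bracket L; \<phi> = hl_twist L in
      finite_dimensional_subspace s V \<and>
      bilinear_on V s V s br \<and>
      (\<forall>u\<in>V. \<forall>v\<in>V. br u v = - br v u) \<and>
      linear_on V s V s \<phi> \<and>
      (\<forall>u\<in>V. \<forall>v\<in>V. \<phi> (br u v) = br (\<phi> u) (\<phi> v)) \<and>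
      (\<forall>u\<in>V. \<forall>v\<in>V. \<forall>w\<in>V.
        br (\<phi> u) (br v w) + br (\<phi> v) (br w u) + br (\<phi> w) (br u v) = 0))"

section \<open>Structures on a Hom-Lie algebra\<close>

definition twisted :: "('k, 'v) hom_lie \<Rightarrow> ('v \<Rightarrow> 'v) \<Rightarrow> 'v \<Rightarrow> 'v"
  where "twisted L J = hl_twist L \<circ> J"

definition almost_complex_structure ::
  "('k, 'v::ab_group_add) hom_lie \<Rightarrow> ('v \<Rightarrow> 'v) \<Rightarrow> bool"
  where "almost_complex_structure L J \<longleftrightarrow>
    (let V = hl_carrier L; s = hl_scale L; \<phi> = hl_twist L in
      linear_on V s V s J \<and> bij_betw J V V \<and>
      (\<forall>x\<in>V. (\<phi> \<circ> J) ((\<phi> \<circ> J) x) = - x) \<and>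
      (\<forall>x\<in>V. (\<phi> \<circ> J) x = (J \<circ> \<phi>) x))"

definition almost_complex_hom_lie_algebra ::
  "('k::field, 'v::ab_group_add) hom_lie \<Rightarrow> ('v \<Rightarrow> 'v) \<Rightarrow> bool"
  where "almost_complex_hom_lie_algebra L J \<longleftrightarrow>
    hom_lie_algebra L \<and> almost_complex_structure L J"

definition integrable_structure ::
  "('k, 'v::ab_group_add) hom_lie \<Rightarrow> ('v \<Rightarrow> 'v) \<Rightarrow> bool"
  where "integrable_structure L J \<longleftrightarrow>
    (let V = hl_carrier L; br = hl_bracket L; \<psi> = twisted L J in
      \<forall>x\<in>V. \<forall>y\<in>V. br (\<psi> x) (\<psi> y) - \<psi> (br (\<psi> x) y) - \<psi> (br x (\<psi> y)) - br x y = 0)"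

definition pseudo_riemannian_metric ::
  "('k::field, 'v::ab_group_add) hom_lie \<Rightarrow> ('v \<Rightarrow> 'v \<Rightarrow> 'k) \<Rightarrow> bool"
  where "pseudo_riemannian_metric L g \<longleftrightarrow>
    (let V = hl_carrier L; \<phi> = hl_twist L in
      bilinear_on V (hl_scale L) UNIV (*) g \<and>
      (\<forall>x\<in>V. \<forall>y\<in>V. g x y = g y x) \<and>
      (\<forall>x\<in>V. (\<forall>y\<in>V. g x y = 0) \<longrightarrow> x = 0) \<and>
      (\<forall>x\<in>V. \<forall>y\<in>V. g (\<phi> x) (\<phi> y) = g x y))"

definition hom_levi_civita_connection ::
  "('k::field, 'v::ab_group_add) hom_lie \<Rightarrow> ('v \<Rightarrow> 'v \<Rightarrow> 'k) \<Rightarrow> ('v \<Rightarrow> 'v \<Rightarrow> 'v) \<Rightarrow> bool"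
  where "hom_levi_civita_connection L g D \<longleftrightarrow>
    (let V = hl_carrier L; s = hl_scale L; \<phi> = hl_twist L in
      bilinear_on V s V s D \<and>
      (\<forall>x\<in>V. \<forall>y\<in>V. hl_bracket L x y = D x y - D y x) \<and>
      (\<forall>x\<in>V. \<forall>y\<in>V. \<forall>z\<in>V. g (D x y) (\<phi> z) = - g (\<phi> y) (D x z)))"

definition norden_metric ::
  "('k::field, 'v::ab_group_add) hom_lie \<Rightarrow> ('v \<Rightarrow> 'v) \<Rightarrow> ('v \<Rightarrow> 'v \<Rightarrow> 'k) \<Rightarrow> bool"
  where "norden_metric L J g \<longleftrightarrow>
    pseudo_riemannian_metric L g \<and>
    (\<forall>x\<in>hl_carrier L. \<forall>y\<in>hl_carrier L. g (twisted L J x) (twisted L J y) = - g x y)"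

definition almost_norden_hom_lie_algebra ::
  "('k::field, 'v::ab_group_add) hom_lie \<Rightarrow> ('v \<Rightarrow> 'v) \<Rightarrow> ('v \<Rightarrow> 'v \<Rightarrow> 'k) \<Rightarrow> bool"
  where "almost_norden_hom_lie_algebra L J g \<longleftrightarrow>
    almost_complex_hom_lie_algebra L J \<and> norden_metric L J g"

text \<open>The Hom-Levi-Civita connection is unique as a map on the carrier, but its values outside
  the carrier are arbitrary; hence the existential quantifier instead of a definite
  description.\<close>

definition kahler_norden_hom_lie_algebra ::
  "('k::field, 'v::ab_group_add) hom_lie \<Rightarrow> ('v \<Rightarrow> 'v) \<Rightarrow> ('v \<Rightarrow> 'v \<Rightarrow> 'k) \<Rightarrow> bool"
  where "kahler_norden_hom_lie_algebra L J g \<longleftrightarrow>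
    almost_norden_hom_lie_algebra L J g \<and>
    (\<exists>D. hom_levi_civita_connection L g D \<and>
      (\<forall>x\<in>hl_carrier L. \<forall>y\<in>hl_carrier L. D x (twisted L J y) = twisted L J (D x y)))"

definition tachibana ::
  "('k::field, 'v::ab_group_add) hom_lie \<Rightarrow> ('v \<Rightarrow> 'v) \<Rightarrow> ('v \<Rightarrow> 'v \<Rightarrow> 'k) \<Rightarrow> 'v \<Rightarrow> 'v \<Rightarrow> 'v \<Rightarrow> 'k"
  where "tachibana L J g x y z =
    (let br = hl_bracket L; \<phi> = hl_twist L; \<psi> = twisted L J in
      g (br y (\<psi> x) - \<psi> (br y x)) (\<phi> z) + g (\<phi> y) (br z (\<psi> x) - \<psi> (br z x)))"

definition holomorphic_norden_hom_lie_algebra ::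
  "('k::field, 'v::ab_group_add) hom_lie \<Rightarrow> ('v \<Rightarrow> 'v) \<Rightarrow> ('v \<Rightarrow> 'v \<Rightarrow> 'k) \<Rightarrow> bool"
  where "holomorphic_norden_hom_lie_algebra L J g \<longleftrightarrow>
    almost_norden_hom_lie_algebra L J g \<and>
    integrable_structure L J \<and>
    (\<forall>x\<in>hl_carrier L. \<forall>y\<in>hl_carrier L. \<forall>z\<in>hl_carrier L. tachibana L J g x y z = 0)"

section \<open>Smooth manifolds\<close>

text \<open>\<open>differentiable_times n f S\<close>: on the open set \<open>S\<close>, \<open>f\<close> is of class \<open>C\<^sup>n\<close>
  (all iterated directional derivatives up to order \<open>n\<close> exist and are continuous). This is used
  for finite-dimensional domains only.\<close>

fun differentiable_times ::
  "nat \<Rightarrow> ('a::real_normed_vector \<Rightarrow> 'b::real_normed_vector) \<Rightarrow> 'a set \<Rightarrow> bool" where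
  "differentiable_times 0 f S \<longleftrightarrow> continuous_on S f"
| "differentiable_times (Suc n) f S \<longleftrightarrow>
    (\<forall>x\<in>S. f differentiable (at x)) \<and>
    (\<forall>v. differentiable_times n (\<lambda>x. frechet_derivative f (at x) v) S)"

definition smooth_on_open :: "('a::real_normed_vector \<Rightarrow> 'b::real_normed_vector) \<Rightarrow> 'a set \<Rightarrow> bool"
  where "smooth_on_open f S \<longleftrightarrow> (\<forall>n. differentiable_times n f S)"

text \<open>A chart is a pair \<open>(U, c)\<close> of a domain and a coordinate map; values of \<open>c\<close> outside \<open>U\<close>
  are irrelevant. The model space is an arbitrary finite-dimensional normed space rather than a
  type of class \<open>euclidean_space\<close>, since the latter would exclude dimension 0.\<close>

type_synonym ('g, 'e) chart = "'g set \<times> ('g \<Rightarrow> 'e)"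

definition is_chart :: "('g::topological_space, 'e::real_normed_vector) chart \<Rightarrow> bool"
  where "is_chart = (\<lambda>(U, c).
    open U \<and> open (c ` U) \<and> homeomorphism U (c ` U) c (inv_into U c))"

definition smooth_atlas :: "('g::topological_space, 'e::real_normed_vector) chart set \<Rightarrow> bool"
  where "smooth_atlas A \<longleftrightarrow>
    (\<exists>B::'e set. finite B \<and> span B = UNIV) \<and>
    (\<forall>C\<in>A. is_chart C) \<and>
    (\<Union>(U, c)\<in>A. U) = UNIV \<and>
    (\<forall>(U, c)\<in>A. \<forall>(V, d)\<in>A. smooth_on_open (d \<circ> inv_into U c) (c ` (U \<inter> V)))"

definition smooth_map ::
  "('g::topological_space, 'e::real_normed_vector) chart set \<Rightarrow>
   ('h::topological_space, 'f::real_normed_vector) chart set \<Rightarrow> ('g \<Rightarrow> 'h) \<Rightarrow> bool"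
  where "smooth_map A B F \<longleftrightarrow>
    continuous_on UNIV F \<and>
    (\<forall>(U, c)\<in>A. \<forall>(V, d)\<in>B. smooth_on_open (d \<circ> F \<circ> inv_into U c) (c ` (U \<inter> F -` V)))"

definition product_atlas ::
  "('g, 'e) chart set \<Rightarrow> ('h, 'f) chart set \<Rightarrow> ('g \<times> 'h, 'e \<times> 'f) chart set"
  where "product_atlas A B = {(U \<times> V, map_prod c d) | U c V d. (U, c) \<in> A \<and> (V, d) \<in> B}"

definition smooth_functions ::
  "('g::topological_space, 'e::real_normed_vector) chart set \<Rightarrow> ('g \<Rightarrow> real) set"
  where "smooth_functions A = {f. smooth_map A {(UNIV, \<lambda>t::real. t)} f}"

section \<open>Hom-Lie groups\<close>

record 'g hom_group_data =
  hg_mult :: "'g \<Rightarrow> 'g \<Rightarrow> 'g"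
  hg_unit :: "'g"
  hg_twist :: "'g \<Rightarrow> 'g"
  hg_inverse :: "'g \<Rightarrow> 'g"

definition hom_group :: "('g, 'z) hom_group_data_scheme \<Rightarrow> bool"
  where "hom_group G \<longleftrightarrow>
    (let m = hg_mult G; e = hg_unit G; \<Phi> = hg_twist G; i = hg_inverse G in
      bij \<Phi> \<and>
      (\<forall>a b. \<Phi> (m a b) = m (\<Phi> a) (\<Phi> b)) \<and>
      (\<forall>a b c. m (\<Phi> a) (m b c) = m (m a b) (\<Phi> c)) \<and>
      (\<forall>a. m a e = \<Phi> a \<and> m e a = \<Phi> a) \<and>
      (\<forall>e'. (\<forall>a. m a e' = \<Phi> a \<and> m e' a = \<Phi> a) \<longrightarrow> e' = e) \<and>
      (\<forall>a. m a (i a) = e \<and> m (i a) a = e))"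

record ('g, 'e) hom_lie_group_data = "'g hom_group_data" +
  hg_atlas :: "('g, 'e) chart set"

definition hom_lie_group ::
  "('g::{t2_space, second_countable_topology}, 'e::real_normed_vector) hom_lie_group_data \<Rightarrow> bool"
  where "hom_lie_group G \<longleftrightarrow>
    (let A = hg_atlas G in
      hom_group G \<and> smooth_atlas A \<and>
      smooth_map A A (hg_twist G) \<and> smooth_map A A (inv (hg_twist G)) \<and>
      smooth_map (product_atlas A A) A (\<lambda>(a, b). hg_mult G a b) \<and>
      smooth_map A A (hg_inverse G))"

text \<open>Sections of the pullback of the tangent bundle along the twist, as twisted derivations of
  the algebra of smooth functions. Their values outside the smooth functions are fixed to be 0,
  so that equality of sections is equality on smooth functions.\<close>

definition pullback_sections ::
  "('g::{t2_space, second_countable_topology}, 'e::real_normed_vector) hom_lie_group_data \<Rightarrow>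
   (('g \<Rightarrow> real) \<Rightarrow> ('g \<Rightarrow> real)) set"
  where "pullback_sections G =
    (let C = smooth_functions (hg_atlas G); \<Phi> = hg_twist G in
      {x. linear_on C (\<lambda>r f a. r * f a) C (\<lambda>r f a. r * f a) x \<and>
          (\<forall>f\<in>C. \<forall>h\<in>C. x (\<lambda>a. f a * h a) = (\<lambda>a. x f a * h (\<Phi> a) + f (\<Phi> a) * x h a)) \<and>
          (\<forall>f. f \<notin> C \<longrightarrow> x f = 0)})"

definition left_invariant_sections ::
  "('g::{t2_space, second_countable_topology}, 'e::real_normed_vector) hom_lie_group_data \<Rightarrow>
   (('g \<Rightarrow> real) \<Rightarrow> ('g \<Rightarrow> real)) set"
  where "left_invariant_sections G =
    {x \<in> pullback_sections G. \<forall>f\<in>smooth_functions (hg_atlas G). \<forall>a.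
      x f a = x (f \<circ> hg_mult G a \<circ> inv (hg_twist G)) (hg_unit G)}"

text \<open>The Hom-Lie algebra of a Hom-Lie group, realised on the left-invariant sections.
  Here \<open>P\<close> is the pullback along the twist and \<open>Q\<close> its inverse.\<close>

definition hom_lie_algebra_of ::
  "('g::{t2_space, second_countable_topology}, 'e::real_normed_vector) hom_lie_group_data \<Rightarrow>
   (real, ('g \<Rightarrow> real) \<Rightarrow> ('g \<Rightarrow> real)) hom_lie"
  where "hom_lie_algebra_of G =
    (let P = (\<lambda>f. f \<circ> hg_twist G); Q = (\<lambda>f. f \<circ> inv (hg_twist G)) in
      \<lparr> hl_carrier = left_invariant_sections G,
        hl_scale = (\<lambda>r x f a. r * x f a),
        hl_bracket = (\<lambda>x y. (P \<circ> x \<circ> Q \<circ> y \<circ> Q) - (P \<circ> y \<circ> Q \<circ> x \<circ> Q)),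
        hl_twist = (\<lambda>x. P \<circ> x \<circ> Q) \<rparr>)"

definition left_invariant_almost_complex_hom_lie_group ::
  "('g::{t2_space, second_countable_topology}, 'e::real_normed_vector) hom_lie_group_data \<Rightarrow>
   ((('g \<Rightarrow> real) \<Rightarrow> ('g \<Rightarrow> real)) \<Rightarrow> (('g \<Rightarrow> real) \<Rightarrow> ('g \<Rightarrow> real))) \<Rightarrow> bool"
  where "left_invariant_almost_complex_hom_lie_group G J \<longleftrightarrow>
    hom_lie_group G \<and> almost_complex_structure (hom_lie_algebra_of G) J"

definition left_invariant_pseudo_riemannian_metric ::
  "('g::{t2_space, second_countable_topology}, 'e::real_normed_vector) hom_lie_group_data \<Rightarrow>
   ((('g \<Rightarrow> real) \<Rightarrow> ('g \<Rightarrow> real)) \<Rightarrow> (('g \<Rightarrow> real) \<Rightarrow> ('g \<Rightarrow> real)) \<Rightarrow> real) \<Rightarrow> bool"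
  where "left_invariant_pseudo_riemannian_metric G g \<longleftrightarrow>
    pseudo_riemannian_metric (hom_lie_algebra_of G) g"

definition left_invariant_kahler_norden_hom_lie_group ::
  "('g::{t2_space, second_countable_topology}, 'e::real_normed_vector) hom_lie_group_data \<Rightarrow>
   ((('g \<Rightarrow> real) \<Rightarrow> ('g \<Rightarrow> real)) \<Rightarrow> (('g \<Rightarrow> real) \<Rightarrow> ('g \<Rightarrow> real))) \<Rightarrow>
   ((('g \<Rightarrow> real) \<Rightarrow> ('g \<Rightarrow> real)) \<Rightarrow> (('g \<Rightarrow> real) \<Rightarrow> ('g \<Rightarrow> real)) \<Rightarrow> real) \<Rightarrow> bool"
  where "left_invariant_kahler_norden_hom_lie_group G J g \<longleftrightarrow>
    hom_lie_group G \<and> kahler_norden_hom_lie_algebra (hom_lie_algebra_of G) J g"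

definition left_invariant_holomorphic_norden_hom_lie_group ::
  "('g::{t2_space, second_countable_topology}, 'e::real_normed_vector) hom_lie_group_data \<Rightarrow>
   ((('g \<Rightarrow> real) \<Rightarrow> ('g \<Rightarrow> real)) \<Rightarrow> (('g \<Rightarrow> real) \<Rightarrow> ('g \<Rightarrow> real))) \<Rightarrow>
   ((('g \<Rightarrow> real) \<Rightarrow> ('g \<Rightarrow> real)) \<Rightarrow> (('g \<Rightarrow> real) \<Rightarrow> ('g \<Rightarrow> real)) \<Rightarrow> real) \<Rightarrow> bool"
  where "left_invariant_holomorphic_norden_hom_lie_group G J g \<longleftrightarrow>
    hom_lie_group G \<and> holomorphic_norden_hom_lie_algebra (hom_lie_algebra_of G) J g"

end

theory Submission
  imports Defs
begin

text \<open>In both directions the almost Norden structure is given, so the claim is that \<open>\<nabla>\<psi> = 0\<close>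
  holds for the Hom-Levi-Civita connection iff \<open>\<psi>\<close> is integrable and the Tachibana tensor
  \<open>\<Phi>\<^sub>\<psi>g\<close> vanishes. Put \<open>S(x,y,z) = g ((\<nabla>\<^sub>x\<psi>) y) (\<phi> z)\<close>. Since \<open>\<nabla>\<^sub>x\<close> is skew and \<open>\<psi>\<close> is
  self-adjoint for \<open>g\<close>, \<open>S\<close> is symmetric in its last two arguments. Replacing brackets by
  covariant derivatives in the Tachibana tensor gives
  \<open>(\<Phi>\<^sub>\<psi>g)(x,y,z) = S(y,x,z) + S(z,x,y) - S(x,y,z)\<close>.
  Hence \<open>\<Phi>\<^sub>\<psi>g\<close> vanishes with \<open>S\<close>. Conversely, adding the instances of \<open>\<Phi>\<^sub>\<psi>g = 0\<close> at
  \<open>(x,y,z)\<close> and \<open>(y,x,z)\<close> leaves, by the symmetry of \<open>S\<close>,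
  \<open>2 S(z,x,y) = 0\<close>, so \<open>S = 0\<close>, which means \<open>\<nabla>\<psi> = 0\<close> because \<open>g\<close>
  is nondegenerate and \<open>\<phi>\<close> is onto. Finally \<open>\<nabla>\<psi> = 0\<close> makes the Nijenhuis tensor of \<open>\<psi>\<close>
  collapse to \<open>\<nabla>\<^sub>xy - \<nabla>\<^sub>yx - [x,y] = 0\<close>.

  For the direction from holomorphic to Kaehler the connection has to be constructed. The Koszul formula
  prescribes \<open>g (\<nabla>\<^sub>xy) (\<phi> z)\<close>, and the nondegenerate form \<open>(w, z) \<mapsto> g w (\<phi> z)\<close> on a
  finite-dimensional space represents every linear functional.

  The argument works over every field of characteristic 0. Being a Hom-Lie algebra is part of both
  notions, so the case of a Hom-Lie group is the case of its algebra of left-invariant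
  sections.\<close>

section \<open>Linear algebra on finite-dimensional subspaces\<close>

lemma linear_onD:
  assumes "linear_on V s W t f"
  shows linear_on_closed: "x \<in> V \<Longrightarrow> f x \<in> W"
    and linear_on_add: "x \<in> V \<Longrightarrow> y \<in> V \<Longrightarrow> f (x + y) = f x + f y"
    and linear_on_scale: "x \<in> V \<Longrightarrow> f (s c x) = t c (f x)"
  using assms unfolding linear_on_def by auto

lemma bilinear_onD:
  assumes "bilinear_on V s W t b"
  shows bilinear_on_left: "y \<in> V \<Longrightarrow> linear_on V s W t (\<lambda>x. b x y)"
    and bilinear_on_right: "x \<in> V \<Longrightarrow> linear_on V s W t (b x)"
  using assms unfolding bilinear_on_def by auto

lemma finite_dimensional_subspace_closed:
  assumes "finite_dimensional_subspace s V"
  shows finite_dimensional_subspace_zero: "0 \<in> V"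
    and finite_dimensional_subspace_add: "x \<in> V \<Longrightarrow> y \<in> V \<Longrightarrow> x + y \<in> V"
    and finite_dimensional_subspace_scale: "x \<in> V \<Longrightarrow> s c x \<in> V"
    and finite_dimensional_subspace_neg: "x \<in> V \<Longrightarrow> - x \<in> V"
    and finite_dimensional_subspace_diff: "x \<in> V \<Longrightarrow> y \<in> V \<Longrightarrow> x - y \<in> V"
proof -
  interpret vector_space s
    using assms by (simp add: finite_dimensional_subspace_def)
  have V: "subspace V"
    using assms by (simp add: finite_dimensional_subspace_def)
  show "0 \<in> V" "x \<in> V \<Longrightarrow> y \<in> V \<Longrightarrow> x + y \<in> V" "x \<in> V \<Longrightarrow> s c x \<in> V" "x \<in> V \<Longrightarrow> - x \<in> V"
    "x \<in> V \<Longrightarrow> y \<in> V \<Longrightarrow> x - y \<in> V"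
    using V by (auto intro: subspace_0 subspace_add subspace_scale subspace_neg subspace_diff)
qed

lemma linear_on_zero:
  assumes "finite_dimensional_subspace s V" "linear_on V s W t f"
  shows "f 0 = 0"
proof -
  have "f (0 + 0) = f 0 + f 0"
    using assms by (blast intro: linear_on_add finite_dimensional_subspace_zero)
  then show ?thesis by simp
qed

lemma linear_on_neg:
  assumes "finite_dimensional_subspace s V" "linear_on V s W t f" "x \<in> V"
  shows "f (- x) = - f x"
proof -
  have "f (x + - x) = f x + f (- x)"
    using assms by (blast intro: linear_on_add finite_dimensional_subspace_neg)
  then have "f x + f (- x) = 0"
    using linear_on_zero[OF assms(1,2)] by simp
  then show ?thesis by (simp add: eq_neg_iff_add_eq_0 add.commute)
qed

lemma linear_on_diff:
  assumes "finite_dimensional_subspace s V" "linear_on V s W t f" "x \<in> V" "y \<in> V"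
  shows "f (x - y) = f x - f y"
  using linear_on_add[OF assms(2,3) finite_dimensional_subspace_neg[OF assms(1,4)]]
    linear_on_neg[OF assms(1,2,4)] by simp

lemma finite_dimensional_subspace_basis:
  assumes "finite_dimensional_subspace s V"
  obtains B where "finite B" "B \<subseteq> V" "\<not> module.dependent s B" "module.span s B = V"
proof -
  interpret vector_space s
    using assms by (simp add: finite_dimensional_subspace_def)
  obtain C where C: "finite C" "C \<subseteq> V" "span C = V" and V: "subspace V"
    using assms by (auto simp: finite_dimensional_subspace_def)
  obtain B where B: "B \<subseteq> V" "independent B" "V \<subseteq> span B"
    using maximal_independent_subset by blast
  have "finite B"
    using independent_span_bound[OF C(1) B(2)] B(1) C(3) by blast
  moreover have "span B = V"
    using B V span_minimal by blast
  ultimately show thesis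
    using that B by blast
qed

lemma linear_on_eq_on_span:
  assumes V: "finite_dimensional_subspace s V" and "module.span s B = V"
    and f: "linear_on V s W t f" and h: "linear_on V s W t h"
    and eq: "\<And>x. x \<in> B \<Longrightarrow> f x = h x" and "x \<in> V"
  shows "f x = h x"
proof -
  interpret vector_space s
    using V by (simp add: finite_dimensional_subspace_def)
  have B: "B \<subseteq> V" using assms(2) span_superset by blast
  have "x \<in> span B" using assms by simp
  then have "x \<in> V \<and> f x = h x"
  proof (induction rule: span_induct_alt)
    case base
    then show ?case
      using finite_dimensional_subspace_zero[OF V] linear_on_zero[OF V f] linear_on_zero[OF V h]
      by simp
  next
    case (step c x y)
    then have "x \<in> V" "s c x \<in> V"
      using B finite_dimensional_subspace_scale[OF V] by auto
    with step show ?case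
      by (simp add: linear_on_add[OF f] linear_on_add[OF h] linear_on_scale[OF f]
          linear_on_scale[OF h] eq finite_dimensional_subspace_add[OF V])
  qed
  then show ?thesis ..
qed

lemma linear_on_inj_imp_surj:
  assumes V: "finite_dimensional_subspace s V" and T: "linear_on V s V s T" and inj: "inj_on T V"
  shows "T ` V = V"
proof -
  interpret vector_space s
    using V by (simp add: finite_dimensional_subspace_def)
  interpret vector_space_pair s s
    by unfold_locales
  obtain B where B: "finite B" "B \<subseteq> V" "independent B" "span B = V"
    using finite_dimensional_subspace_basis[OF V] .
  \<comment> \<open>\<open>T\<close> is linear only on \<open>V\<close>; the theory of linear maps needs an extension to the whole type.\<close>
  define T' where "T' = construct B T"
  have lin: "Vector_Spaces.linear s s T'"
    unfolding T'_def using B(3) by (rule linear_construct)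
  then interpret T': Vector_Spaces.linear s s T' .
  have TB: "T ` B \<subseteq> V"
    using B(2) linear_on_closed[OF T] by blast
  have T'B: "T' b = T b" if "b \<in> B" for b
    unfolding T'_def using B(3) that by (rule construct_basis)
  have img: "T' ` V \<subseteq> V"
  proof -
    have "T' ` V = span (T' ` B)"
      using T'.span_image[of B] B(4) by simp
    also have "\<dots> \<subseteq> span V"
      using TB T'B by (intro span_mono) auto
    also have "\<dots> = V"
      using B(4) span_span by metis
    finally show ?thesis .
  qed
  have lin_on: "linear_on V s V s T'"
    unfolding linear_on_def using img by (auto simp: T'.add T'.scale)
  have eq: "T' x = T x" if "x \<in> V" for x
    using linear_on_eq_on_span[OF V B(4) lin_on T T'B that] .
  have "inj_on T' (span B)"
    using inj eq B(4) by (simp add: inj_on_def)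
  then have ind: "independent (T' ` B)"
    using lin B(3) by (intro linear_independent_injective_image)
  have card: "card (T' ` B) = card B"
    using \<open>inj_on T' (span B)\<close> by (intro card_image) (meson inj_on_subset span_superset)
  have "T' ` B \<subseteq> span B"
    using img B by auto
  \<comment> \<open>An element of \<open>B\<close> outside the span of the image would enlarge an independent set that
    already has as many elements as \<open>B\<close>.\<close>
  have "b \<in> span (T' ` B)" if "b \<in> B" for b
  proof (rule ccontr)
    assume b: "b \<notin> span (T' ` B)"
    then have "independent (insert b (T' ` B))"
      using ind by (simp add: independent_insert)
    moreover have "insert b (T' ` B) \<subseteq> span B"
      using \<open>T' ` B \<subseteq> span B\<close> that by (simp add: span_base)
    ultimately have "card (insert b (T' ` B)) \<le> card B"
      using independent_span_bound[OF B(1)] by blast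
    moreover have "b \<notin> T' ` B"
      using b span_base by blast
    ultimately show False
      using B(1) card by simp
  qed
  then have "span B \<subseteq> span (T' ` B)"
    by (intro span_minimal subsetI) auto
  then have "V \<subseteq> T' ` V"
    using T'.span_image[of B] B(4) by simp
  then show ?thesis
    using img eq by auto
qed

text \<open>In coordinates with respect to a basis \<open>B\<close>, the map \<open>x \<mapsto> b x\<close> into the dual space becomes the
  endomorphism \<open>x \<mapsto> \<Sum>c\<in>B. b x c \<cdot> c\<close>. Nondegeneracy makes it injective, hence surjective.\<close>

lemma nondegenerate_form_represents_functional:
  assumes V: "finite_dimensional_subspace s V"
    and b: "bilinear_on V s UNIV (*) b"
    and nondeg: "\<forall>x\<in>V. (\<forall>y\<in>V. b x y = 0) \<longrightarrow> x = 0"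
    and f: "linear_on V s UNIV (*) f"
  shows "\<exists>x\<in>V. \<forall>y\<in>V. b x y = f y"
proof -
  interpret vector_space s
    using V by (simp add: finite_dimensional_subspace_def)
  obtain B where B: "finite B" "B \<subseteq> V" "independent B" "span B = V"
    using finite_dimensional_subspace_basis[OF V] .
  have sub: "subspace V" using B(4) subspace_span by metis
  have comb: "(\<Sum>c\<in>B. s (u c) c) \<in> V" for u
    using B(2) by (intro subspace_sum[OF sub] subspace_scale[OF sub]) auto
  have coord: "u c = v c" if "(\<Sum>c\<in>B. s (u c) c) = (\<Sum>c\<in>B. s (v c) c)" "c \<in> B" for u v c
  proof -
    have "(\<Sum>c\<in>B. s (u c - v c) c) = 0"
      using that(1) by (simp add: scale_left_diff_distrib sum_subtractf)
    then show ?thesis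
      using independentD[OF B(3,1) subset_refl, of "\<lambda>c. u c - v c" c] that(2) by simp
  qed
  define T where "T x = (\<Sum>c\<in>B. s (b x c) c)" for x
  have T: "linear_on V s V s T"
    unfolding linear_on_def T_def
    using B(2) comb
    by (auto simp: linear_on_add[OF bilinear_on_left[OF b]] subset_iff scale_sum_right
        linear_on_scale[OF bilinear_on_left[OF b]] scale_left_distrib
        simp flip: sum.distrib intro!: sum.cong)
  have "inj_on T V"
  proof (rule inj_onI)
    fix x y assume xy: "x \<in> V" "y \<in> V" "T x = T y"
    have "b x c = b y c" if "c \<in> B" for c
      using coord[OF xy(3)[unfolded T_def] that] .
    then have "b x z = b y z" if "z \<in> V" for z
      using linear_on_eq_on_span[OF V B(4) bilinear_on_right[OF b xy(1)]
          bilinear_on_right[OF b xy(2)] _ that] by blast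
    then have "b (x - y) z = 0" if "z \<in> V" for z
      using that linear_on_diff[OF V bilinear_on_left[OF b that] xy(1,2)] by simp
    then have "x - y = 0"
      using nondeg finite_dimensional_subspace_diff[OF V xy(1,2)] by blast
    then show "x = y" by simp
  qed
  then have "T ` V = V"
    using linear_on_inj_imp_surj[OF V T] by blast
  then obtain x where x: "x \<in> V" "T x = (\<Sum>c\<in>B. s (f c) c)"
    using comb by (metis (no_types, lifting) imageE)
  have "b x c = f c" if "c \<in> B" for c
    using coord[OF x(2)[unfolded T_def] that] .
  then have "b x y = f y" if "y \<in> V" for y
    using linear_on_eq_on_span[OF V B(4) bilinear_on_right[OF b x(1)] f _ that] by blast
  with x(1) show ?thesis by blast
qed

section \<open>The Hom-Levi-Civita connection\<close>

locale metric_hom_lie_algebra =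
  fixes L :: "('k::field_char_0, 'v::ab_group_add) hom_lie" and g :: "'v \<Rightarrow> 'v \<Rightarrow> 'k"
  assumes hom_lie: "hom_lie_algebra L" and metric: "pseudo_riemannian_metric L g"
begin

abbreviation "V \<equiv> hl_carrier L"
abbreviation "s \<equiv> hl_scale L"
abbreviation "br \<equiv> hl_bracket L"
abbreviation "\<phi> \<equiv> hl_twist L"

lemma
  shows findim: "finite_dimensional_subspace s V"
    and bracket_bilinear: "bilinear_on V s V s br"
    and bracket_skew: "x \<in> V \<Longrightarrow> y \<in> V \<Longrightarrow> br x y = - br y x"
    and twist_linear: "linear_on V s V s \<phi>"
  using hom_lie unfolding hom_lie_algebra_def Let_def by blast+

lemma
  shows metric_bilinear: "bilinear_on V s UNIV (*) g"
    and metric_sym: "x \<in> V \<Longrightarrow> y \<in> V \<Longrightarrow> g x y = g y x"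
    and metric_nondegenerate: "x \<in> V \<Longrightarrow> (\<And>y. y \<in> V \<Longrightarrow> g x y = 0) \<Longrightarrow> x = 0"
    and metric_twist: "x \<in> V \<Longrightarrow> y \<in> V \<Longrightarrow> g (\<phi> x) (\<phi> y) = g x y"
  using metric unfolding pseudo_riemannian_metric_def Let_def by blast+

lemmas carrier_closed =
  finite_dimensional_subspace_closed[OF findim]
  linear_on_closed[OF twist_linear]
  linear_on_closed[OF bilinear_on_right[OF bracket_bilinear]]

lemmas bracket_simps =
  linear_on_add[OF bilinear_on_left[OF bracket_bilinear]]
  linear_on_add[OF bilinear_on_right[OF bracket_bilinear]]
  linear_on_scale[OF bilinear_on_left[OF bracket_bilinear]]
  linear_on_scale[OF bilinear_on_right[OF bracket_bilinear]]

lemmas metric_simps =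
  linear_on_add[OF bilinear_on_left[OF metric_bilinear]]
  linear_on_add[OF bilinear_on_right[OF metric_bilinear]]
  linear_on_scale[OF bilinear_on_left[OF metric_bilinear]]
  linear_on_scale[OF bilinear_on_right[OF metric_bilinear]]
  linear_on_neg[OF findim bilinear_on_left[OF metric_bilinear]]
  linear_on_neg[OF findim bilinear_on_right[OF metric_bilinear]]
  linear_on_diff[OF findim bilinear_on_left[OF metric_bilinear]]
  linear_on_diff[OF findim bilinear_on_right[OF metric_bilinear]]

lemmas twist_simps =
  linear_on_add[OF twist_linear] linear_on_scale[OF twist_linear]

text \<open>An isometry of a nondegenerate form is injective, and the dimension is finite.\<close>

lemma twist_surj: "\<phi> ` V = V"
proof (rule linear_on_inj_imp_surj[OF findim twist_linear], rule inj_onI)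
  fix x y assume xy: "x \<in> V" "y \<in> V" "\<phi> x = \<phi> y"
  have "g (x - y) z = 0" if "z \<in> V" for z
    using metric_twist[OF xy(1) that] metric_twist[OF xy(2) that] xy that
    by (simp add: metric_simps)
  then have "x - y = 0"
    using xy by (intro metric_nondegenerate) (simp_all add: carrier_closed)
  then show "x = y" by simp
qed

lemma twisted_metric_bilinear: "bilinear_on V s UNIV (*) (\<lambda>x z. g x (\<phi> z))"
  unfolding bilinear_on_def linear_on_def
  by (simp add: metric_simps twist_simps carrier_closed)

lemma twisted_metric_nondegenerate:
  assumes "x \<in> V" "\<And>z. z \<in> V \<Longrightarrow> g x (\<phi> z) = 0"
  shows "x = 0"
proof (rule metric_nondegenerate[OF assms(1)])
  fix y assume "y \<in> V"
  then obtain z where "z \<in> V" "y = \<phi> z"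
    using twist_surj by blast
  then show "g x y = 0"
    using assms(2) by simp
qed

lemma twisted_metric_eqI:
  assumes "x \<in> V" "y \<in> V" "\<And>z. z \<in> V \<Longrightarrow> g x (\<phi> z) = g y (\<phi> z)"
  shows "x = y"
proof -
  have "g (x - y) (\<phi> z) = 0" if "z \<in> V" for z
    using assms(3)[OF that] assms(1,2) that by (simp add: metric_simps carrier_closed)
  then have "x - y = 0"
    using assms(1,2) by (intro twisted_metric_nondegenerate) (simp_all add: carrier_closed)
  then show ?thesis by simp
qed

text \<open>The value that the Koszul formula forces for \<open>g (\<nabla>\<^sub>xy) (\<phi> z)\<close>: the metric condition says that
  this trilinear form is skew in \<open>y\<close> and \<open>z\<close>, so the classical cyclic elimination applies. No
  derivatives of \<open>g\<close> occur, as on a Lie group with a left-invariant metric.\<close>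

definition koszul :: "'v \<Rightarrow> 'v \<Rightarrow> 'v \<Rightarrow> 'k" where
  "koszul x y z = (g (br x y) (\<phi> z) + g (br z x) (\<phi> y) + g (br z y) (\<phi> x)) / 2"

lemma koszul_linear:
  assumes "x \<in> V" "y \<in> V"
  shows "linear_on V s UNIV (*) (koszul x y)"
    and "linear_on V s UNIV (*) (\<lambda>z. koszul x z y)"
    and "linear_on V s UNIV (*) (\<lambda>z. koszul z x y)"
  using assms unfolding linear_on_def koszul_def
  by (simp_all add: bracket_simps metric_simps twist_simps carrier_closed field_simps)

text \<open>The Koszul value is linear in \<open>z\<close>, so a vector \<open>\<nabla>\<^sub>xy\<close> represents it; this vector is unique,
  whence linearity in \<open>x\<close> and \<open>y\<close>.\<close>

lemma hom_levi_civita_connection_exists: "\<exists>D. hom_levi_civita_connection L g D"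
proof -
  have "\<exists>w\<in>V. \<forall>z\<in>V. g w (\<phi> z) = koszul x y z" if "x \<in> V" "y \<in> V" for x y
  proof (rule nondegenerate_form_represents_functional[OF findim twisted_metric_bilinear _
        koszul_linear(1)[OF that]])
    show "\<forall>w\<in>V. (\<forall>z\<in>V. g w (\<phi> z) = 0) \<longrightarrow> w = 0"
      by (auto intro: twisted_metric_nondegenerate)
  qed
  then obtain D where D: "\<And>x y. x \<in> V \<Longrightarrow> y \<in> V \<Longrightarrow> D x y \<in> V"
    and K: "\<And>x y z. x \<in> V \<Longrightarrow> y \<in> V \<Longrightarrow> z \<in> V \<Longrightarrow> g (D x y) (\<phi> z) = koszul x y z"
    by metis
  have "bilinear_on V s V s D"
    unfolding bilinear_on_def linear_on_def
    by (auto intro!: twisted_metric_eqI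
        simp: D K metric_simps carrier_closed linear_on_add[OF koszul_linear(2)]
        linear_on_add[OF koszul_linear(3)] linear_on_scale[OF koszul_linear(2)]
        linear_on_scale[OF koszul_linear(3)])
  moreover have "br x y = D x y - D y x" if xy: "x \<in> V" "y \<in> V" for x y
  proof (rule twisted_metric_eqI)
    fix z assume z: "z \<in> V"
    have "g (br y x) (\<phi> z) = - g (br x y) (\<phi> z)"
      using bracket_skew[OF xy(2,1)] xy z by (simp add: metric_simps carrier_closed)
    then show "g (br x y) (\<phi> z) = g (D x y - D y x) (\<phi> z)"
      using xy z by (simp add: metric_simps carrier_closed D K koszul_def field_simps)
  qed (use xy in \<open>auto simp: D carrier_closed\<close>)
  moreover have "g (D x y) (\<phi> z) = - g (\<phi> y) (D x z)" if xyz: "x \<in> V" "y \<in> V" "z \<in> V" for x y z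
  proof -
    have skew: "g (br a b) (\<phi> c) = - g (br b a) (\<phi> c)" if "a \<in> V" "b \<in> V" "c \<in> V" for a b c
      using bracket_skew[OF that(1,2)] that by (simp add: metric_simps carrier_closed)
    have "g (\<phi> y) (D x z) = koszul x z y"
      using metric_sym[of "\<phi> y" "D x z"] xyz by (simp add: D K carrier_closed)
    moreover have "koszul x y z = - koszul x z y"
      using skew[of x y z] skew[of z x y] skew[of z y x] xyz
      by (simp add: koszul_def field_simps)
    ultimately show ?thesis
      using xyz by (simp add: K)
  qed
  ultimately show ?thesis
    unfolding hom_levi_civita_connection_def Let_def by blast
qed

end

section \<open>Parallelism of the twisted complex structure\<close>

locale almost_norden = metric_hom_lie_algebra L g
  for L :: "('k::field_char_0, 'v::ab_group_add) hom_lie" and J and g +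
  assumes almost_complex: "almost_complex_structure L J" and norden: "norden_metric L J g"
begin

abbreviation "\<psi> \<equiv> twisted L J"

lemma structure_linear: "linear_on V s V s J"
  using almost_complex by (simp add: almost_complex_structure_def Let_def)

lemma twisted_linear: "linear_on V s V s \<psi>"
  using structure_linear twist_linear unfolding twisted_def linear_on_def by simp

lemma twisted_twisted: "x \<in> V \<Longrightarrow> \<psi> (\<psi> x) = - x"
  using almost_complex unfolding twisted_def almost_complex_structure_def Let_def by blast

lemma twisted_twist_commute: "x \<in> V \<Longrightarrow> \<psi> (\<phi> x) = \<phi> (\<psi> x)"
  using almost_complex linear_on_closed[OF twist_linear]
  unfolding twisted_def almost_complex_structure_def Let_def by simp

lemmas twisted_simps =
  linear_on_add[OF twisted_linear] linear_on_neg[OF findim twisted_linear]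
  linear_on_diff[OF findim twisted_linear]

lemmas twisted_closed = linear_on_closed[OF twisted_linear]

lemma twisted_self_adjoint:
  assumes "x \<in> V" "y \<in> V"
  shows "g (\<psi> x) y = g x (\<psi> y)"
proof -
  have "g (\<psi> x) (\<psi> (\<psi> y)) = - g x (\<psi> y)"
    using norden assms twisted_closed unfolding norden_metric_def by blast
  then show ?thesis
    using assms by (simp add: twisted_twisted metric_simps twisted_closed)
qed

lemma twisted_self_adjoint_twist:
  assumes "x \<in> V" "z \<in> V"
  shows "g (\<psi> x) (\<phi> z) = g x (\<phi> (\<psi> z))"
  using assms by (simp add: twisted_self_adjoint carrier_closed twisted_twist_commute)

end

locale almost_norden_connection = almost_norden L J g
  for L :: "('k::field_char_0, 'v::ab_group_add) hom_lie" and J and g +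
  fixes D assumes levi_civita: "hom_levi_civita_connection L g D"
begin

lemma
  shows connection_bilinear: "bilinear_on V s V s D"
    and torsion_free: "x \<in> V \<Longrightarrow> y \<in> V \<Longrightarrow> br x y = D x y - D y x"
    and connection_metric: "x \<in> V \<Longrightarrow> y \<in> V \<Longrightarrow> z \<in> V \<Longrightarrow> g (D x y) (\<phi> z) = - g (\<phi> y) (D x z)"
  using levi_civita unfolding hom_levi_civita_connection_def Let_def by blast+

lemmas connection_closed = linear_on_closed[OF bilinear_on_right[OF connection_bilinear]]

lemmas closed = carrier_closed twisted_closed connection_closed

lemma connection_skew:
  assumes "x \<in> V" "y \<in> V" "z \<in> V"
  shows "g (D x y) (\<phi> z) = - g (D x z) (\<phi> y)"
  using connection_metric[OF assms] metric_sym[of "D x z" "\<phi> y"] assms by (simp add: closed)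

definition parallel :: bool where
  "parallel \<longleftrightarrow> (\<forall>x\<in>V. \<forall>y\<in>V. D x (\<psi> y) = \<psi> (D x y))"

text \<open>The covariant derivative of \<open>\<psi>\<close>, lowered to a trilinear form by the twisted metric.\<close>

definition nabla_psi :: "'v \<Rightarrow> 'v \<Rightarrow> 'v \<Rightarrow> 'k" where
  "nabla_psi x y z = g (D x (\<psi> y) - \<psi> (D x y)) (\<phi> z)"

lemma nabla_psi_eq:
  assumes "x \<in> V" "y \<in> V" "z \<in> V"
  shows "nabla_psi x y z = g (D x (\<psi> y)) (\<phi> z) - g (D x y) (\<phi> (\<psi> z))"
  using assms by (simp add: nabla_psi_def metric_simps closed twisted_self_adjoint_twist)

text \<open>Moving \<open>\<psi>\<close> across the metric and then swapping arguments by skewness of \<open>\<nabla>\<^sub>x\<close> exchanges the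
  two terms of \<open>nabla_psi_eq\<close> together with their signs.\<close>

lemma nabla_psi_sym:
  assumes "x \<in> V" "y \<in> V" "z \<in> V"
  shows "nabla_psi x y z = nabla_psi x z y"
  using assms connection_skew[of x "\<psi> y" z] connection_skew[of x y "\<psi> z"]
  by (simp add: nabla_psi_eq closed)

lemma parallel_iff_nabla_psi_zero:
  "parallel \<longleftrightarrow> (\<forall>x\<in>V. \<forall>y\<in>V. \<forall>z\<in>V. nabla_psi x y z = 0)"
proof
  assume "parallel"
  then show "\<forall>x\<in>V. \<forall>y\<in>V. \<forall>z\<in>V. nabla_psi x y z = 0"
    by (simp add: parallel_def nabla_psi_eq closed flip: twisted_self_adjoint_twist)
next
  assume *: "\<forall>x\<in>V. \<forall>y\<in>V. \<forall>z\<in>V. nabla_psi x y z = 0"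
  then have "g (D x (\<psi> y)) (\<phi> z) = g (\<psi> (D x y)) (\<phi> z)" if "x \<in> V" "y \<in> V" "z \<in> V" for x y z
    using that by (simp add: nabla_psi_eq twisted_self_adjoint_twist closed)
  then show "parallel"
    unfolding parallel_def by (auto intro!: twisted_metric_eqI simp: closed)
qed

text \<open>By torsion-freeness \<open>[y, \<psi>x] - \<psi>[y, x] = (\<nabla>\<^sub>y\<psi>) x + \<psi>(\<nabla>\<^sub>xy) - \<nabla>\<^sub>\<psi>\<^sub>xy\<close>, and likewise for \<open>z\<close>. In the
  sum of the two pairings the terms with \<open>\<nabla>\<^sub>\<psi>\<^sub>x\<close> cancel because \<open>\<nabla>\<close> is metric, and those with
  \<open>\<psi>\<nabla>\<^sub>x\<close> combine to \<open>- g ((\<nabla>\<^sub>x\<psi>) y) (\<phi> z)\<close>.\<close>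

lemma tachibana_eq_nabla_psi:
  assumes "x \<in> V" "y \<in> V" "z \<in> V"
  shows "tachibana L J g x y z = nabla_psi y x z + nabla_psi z x y - nabla_psi x y z"
proof -
  have half: "g (br y (\<psi> x) - \<psi> (br y x)) (\<phi> z) =
      nabla_psi y x z + g (D x y) (\<phi> (\<psi> z)) - g (D (\<psi> x) y) (\<phi> z)"
    if "x \<in> V" "y \<in> V" "z \<in> V" for x y z
    using that
    by (simp add: torsion_free closed twisted_simps metric_simps nabla_psi_eq
        twisted_self_adjoint_twist)
  have "g (\<phi> y) (br z (\<psi> x) - \<psi> (br z x)) = g (br z (\<psi> x) - \<psi> (br z x)) (\<phi> y)"
    using assms by (intro metric_sym) (simp_all add: closed)
  then have "tachibana L J g x y z = nabla_psi y x z + nabla_psi z x y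
      + g (D x y) (\<phi> (\<psi> z)) + g (D x z) (\<phi> (\<psi> y))
      - (g (D (\<psi> x) y) (\<phi> z) + g (D (\<psi> x) z) (\<phi> y))"
    using assms half[of x y z] half[of x z y] by (simp add: tachibana_def Let_def)
  also have "g (D (\<psi> x) y) (\<phi> z) + g (D (\<psi> x) z) (\<phi> y) = 0"
    using assms connection_skew[of "\<psi> x" y z] by (simp add: closed)
  also have "g (D x z) (\<phi> (\<psi> y)) = - g (D x (\<psi> y)) (\<phi> z)"
    using assms by (intro connection_skew) (simp_all add: closed)
  finally show ?thesis
    using assms by (simp add: nabla_psi_eq)
qed

lemma parallel_iff_tachibana_zero:
  "parallel \<longleftrightarrow> (\<forall>x\<in>V. \<forall>y\<in>V. \<forall>z\<in>V. tachibana L J g x y z = 0)"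
proof
  assume "parallel"
  then show "\<forall>x\<in>V. \<forall>y\<in>V. \<forall>z\<in>V. tachibana L J g x y z = 0"
    by (simp add: tachibana_eq_nabla_psi parallel_iff_nabla_psi_zero)
next
  assume *: "\<forall>x\<in>V. \<forall>y\<in>V. \<forall>z\<in>V. tachibana L J g x y z = 0"
  have "nabla_psi z x y = 0" if xyz: "x \<in> V" "y \<in> V" "z \<in> V" for x y z
  proof -
    have "nabla_psi x y z = nabla_psi y x z + nabla_psi z x y"
      using * xyz by (simp add: tachibana_eq_nabla_psi)
    moreover have "nabla_psi y x z = nabla_psi x y z + nabla_psi z x y"
      using * xyz by (simp add: tachibana_eq_nabla_psi nabla_psi_sym[of z x y])
    ultimately have "2 * nabla_psi z x y = 0" by simp
    then show ?thesis by simp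
  qed
  then show "parallel"
    by (simp add: parallel_iff_nabla_psi_zero)
qed

text \<open>With \<open>\<nabla>\<psi> = 0\<close> and \<open>\<psi>\<^sup>2 = -1\<close>, the terms \<open>\<psi>\<nabla>\<^sub>\<psi>\<^sub>xy\<close> and \<open>\<psi>\<nabla>\<^sub>\<psi>\<^sub>yx\<close> of the
  Nijenhuis tensor cancel, and the remaining ones are the torsion.\<close>

lemma parallel_imp_integrable:
  assumes "parallel"
  shows "integrable_structure L J"
proof -
  have "br (\<psi> x) (\<psi> y) - \<psi> (br (\<psi> x) y) - \<psi> (br x (\<psi> y)) - br x y = 0"
    if "x \<in> V" "y \<in> V" for x y
    using assms that
    by (simp add: parallel_def torsion_free closed twisted_simps twisted_twisted)
  then show ?thesis
    by (simp add: integrable_structure_def Let_def)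
qed

end

lemma kahler_norden_iff_holomorphic_norden:
  fixes L :: "('k::field_char_0, 'v::ab_group_add) hom_lie"
  shows "kahler_norden_hom_lie_algebra L J g \<longleftrightarrow> holomorphic_norden_hom_lie_algebra L J g"
proof (cases "almost_norden_hom_lie_algebra L J g")
  case False
  then show ?thesis
    by (simp add: kahler_norden_hom_lie_algebra_def holomorphic_norden_hom_lie_algebra_def)
next
  case True
  then interpret almost_norden L J g
    by unfold_locales
      (auto simp: almost_norden_hom_lie_algebra_def almost_complex_hom_lie_algebra_def
        norden_metric_def)
  show ?thesis
  proof
    assume "kahler_norden_hom_lie_algebra L J g"
    then obtain D where D: "hom_levi_civita_connection L g D"
      and par: "\<forall>x\<in>V. \<forall>y\<in>V. D x (\<psi> y) = \<psi> (D x y)"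
      unfolding kahler_norden_hom_lie_algebra_def by blast
    interpret almost_norden_connection L J g D
      using D by unfold_locales
    have "parallel" using par by (simp add: parallel_def)
    then show "holomorphic_norden_hom_lie_algebra L J g"
      using True parallel_imp_integrable parallel_iff_tachibana_zero
      unfolding holomorphic_norden_hom_lie_algebra_def by blast
  next
    assume hol: "holomorphic_norden_hom_lie_algebra L J g"
    obtain D where D: "hom_levi_civita_connection L g D"
      using hom_levi_civita_connection_exists by blast
    interpret almost_norden_connection L J g D
      using D by unfold_locales
    have "parallel"
      using hol parallel_iff_tachibana_zero
      unfolding holomorphic_norden_hom_lie_algebra_def by blast
    then show "kahler_norden_hom_lie_algebra L J g"
      using True D unfolding kahler_norden_hom_lie_algebra_def parallel_def by blast
  qed
qed

theorem proposition5p5: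
  shows
    "(\<forall>(L :: (real, 'v::ab_group_add) hom_lie) J g.
        almost_complex_hom_lie_algebra L J \<longrightarrow> pseudo_riemannian_metric L g \<longrightarrow>
        (kahler_norden_hom_lie_algebra L J g \<longleftrightarrow> holomorphic_norden_hom_lie_algebra L J g)) \<and>
     (\<forall>(L :: (complex, 'w::ab_group_add) hom_lie) J g.
        almost_complex_hom_lie_algebra L J \<longrightarrow> pseudo_riemannian_metric L g \<longrightarrow>
        (kahler_norden_hom_lie_algebra L J g \<longleftrightarrow> holomorphic_norden_hom_lie_algebra L J g)) \<and>
     (\<forall>(G :: ('g::{t2_space, second_countable_topology}, 'e::real_normed_vector) hom_lie_group_data) J g.
        left_invariant_almost_complex_hom_lie_group G J \<longrightarrow>
        left_invariant_pseudo_riemannian_metric G g \<longrightarrow>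
        (left_invariant_kahler_norden_hom_lie_group G J g \<longleftrightarrow>
         left_invariant_holomorphic_norden_hom_lie_group G J g))"
  by (simp add: kahler_norden_iff_holomorphic_norden left_invariant_kahler_norden_hom_lie_group_def
      left_invariant_holomorphic_norden_hom_lie_group_def)

end
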